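(* Let $G$ be a locally compact group, $\Gamma\subset G$, let $(\pi,\mathcal{H}_\pi)$ be a square-integrable representation of $G$, and let $\eta\in\mathcal{H}_\pi$ be an admissible vector. Assume in addition that $\pi(\Gamma)\eta = (\pi(\gamma)\eta)_{\gamma\in\Gamma}$ is a tight frame of $\mathcal{H}_\pi$ with frame constant $c_\eta$. Then $\mathcal{H} = V_\eta(\mathcal{H}_\pi)\subset L^2(G)$ is a sampling space with respect to $\Gamma$, and $S = \frac{1}{c_\eta}V_\eta\eta$ is the associated sinc-type function for $\mathcal{H}$.
   Context: $L^2(G)$ is taken with respect to left Haar measure; representations are strongly continuous and unitary. For a representation $(\pi,\mathcal{H}_\pi)$ and $\eta\in\mathcal{H}_\pi$ put $V_\eta\varphi(x) = \langle\varphi,\pi(x)\eta\rangle$. The vector $\eta$ is admissible if $V_\eta$ is an isometry $\mathcal{H}_\pi\to L^2(G)$; $\pi$ is called square-integrable if it has an admissible vector (no irreducibility is assumed). A family $(\eta_i)_{i\in I}$ in a Hilbert space $\mathcal{K}$ is a tight frame with frame constant $c>0$ if $\sum_i|\langle\varphi,\eta_i\rangle|^2 = c\|\varphi\|^2$ for all $\varphi\in\mathcal{K}$. Sampling space: let $\mathcal{H}\subset L^2(G)$ be a closed subspace, invariant under left translations, consisting of continuous functions. $\mathcal{H}$ is a sampling space with respect to $\Gamma$ if (i) there is a constant $c_{\mathcal{H}}>0$ with $\sum_{\gamma\in\Gamma}|f(\gamma)|^2 = c_{\mathcal{H}}\|f\|_2^2$ for all $f\in\mathcal{H}$; and (ii)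 there exists $S\in\mathcal{H}$ such that every $f\in\mathcal{H}$ has the expansion $f(x) = \sum_{\gamma\in\Gamma} f(\gamma)S(\gamma^{-1}x)$, with convergence both in $L^2$ and uniformly. The function $S$ in (ii) is called a sinc-type function. *)

theory Defs
  imports "HOL-Analysis.Analysis"
begin

section \<open>Complex Hilbert spaces\<close>

text \<open>The norm, metric and topology are those of the underlying real inner product space.
  The complex inner product is linear in its first argument.\<close>

class chilbert_space = real_inner + complete_space +
  fixes scaleC :: "complex \<Rightarrow> 'a \<Rightarrow> 'a" (infixr "*\<^sub>C" 75)
    and cinner :: "'a \<Rightarrow> 'a \<Rightarrow> complex"
  assumes scaleC_add_right: "a *\<^sub>C (x + y) = a *\<^sub>C x + a *\<^sub>C y"
    and scaleC_add_left: "(a + b) *\<^sub>C x = a *\<^sub>C x + b *\<^sub>C x"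
    and scaleC_scaleC: "a *\<^sub>C (b *\<^sub>C x) = (a * b) *\<^sub>C x"
    and scaleR_scaleC: "r *\<^sub>R x = complex_of_real r *\<^sub>C x"
    and cinner_commute: "cinner x y = cnj (cinner y x)"
    and cinner_add_left: "cinner (x + y) z = cinner x z + cinner y z"
    and cinner_scaleC_left: "cinner (a *\<^sub>C x) y = a * cinner x y"
    and inner_eq_Re_cinner: "inner x y = Re (cinner x y)"

instantiation complex :: chilbert_space
begin

definition scaleC_complex :: "complex \<Rightarrow> complex \<Rightarrow> complex"
  where "scaleC_complex a x = a * x"

definition cinner_complex :: "complex \<Rightarrow> complex \<Rightarrow> complex"
  where "cinner_complex x y = x * cnj y"

instance
  by standard
    (auto simp: scaleC_complex_def cinner_complex_def algebra_simps scaleR_conv_of_real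
      inner_complex_def)

end

definition tight_frame :: "'i set \<Rightarrow> ('i \<Rightarrow> 'h::chilbert_space) \<Rightarrow> real \<Rightarrow> bool"
  where "tight_frame I e c \<longleftrightarrow>
    c > 0 \<and> (\<forall>\<phi>. ((\<lambda>i. (cmod (cinner \<phi> (e i)))\<^sup>2) has_sum (c * (norm \<phi>)\<^sup>2)) I)"


section \<open>Left Haar measure and \<open>L\<^sup>2\<close>\<close>

text \<open>Groups are written additively, because the topological groups of the library are;
  \<^class>\<open>topological_group_add\<close> does not assume commutativity. So \<open>x + y\<close> is the group product
  and \<open>- x\<close> the inverse of \<open>x\<close>.

  A left Haar measure is a nonzero left invariant Radon measure on the Borel sets, where
  Radon means: finite on compact sets, outer regular on Borel sets, inner regular on open
  sets. No \<open>\<sigma>\<close>-compactness is assumed.\<close>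

definition left_haar_measure :: "'g::{topological_group_add, t2_space} measure \<Rightarrow> bool"
  where "left_haar_measure \<mu> \<longleftrightarrow>
    sets \<mu> = sets borel \<and>
    emeasure \<mu> UNIV \<noteq> 0 \<and>
    (\<forall>x. \<forall>A \<in> sets borel. emeasure \<mu> ((\<lambda>y. x + y) ` A) = emeasure \<mu> A) \<and>
    (\<forall>K. compact K \<longrightarrow> emeasure \<mu> K < \<infinity>) \<and>
    (\<forall>A \<in> sets borel. emeasure \<mu> A = (INF U \<in> {U. open U \<and> A \<subseteq> U}. emeasure \<mu> U)) \<and>
    (\<forall>U. open U \<longrightarrow> emeasure \<mu> U = (SUP K \<in> {K. compact K \<and> K \<subseteq> U}. emeasure \<mu> K))"

text \<open>Elements of \<open>L\<^sup>2\<close> are represented by functions; equality in \<open>L\<^sup>2\<close> is equality almost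
  everywhere.\<close>

definition L2 :: "'g measure \<Rightarrow> ('g \<Rightarrow> complex) set"
  where "L2 \<mu> = {f \<in> borel_measurable \<mu>. integrable \<mu> (\<lambda>x. (cmod (f x))\<^sup>2)}"

definition L2_norm :: "'g measure \<Rightarrow> ('g \<Rightarrow> complex) \<Rightarrow> real"
  where "L2_norm \<mu> f = sqrt (\<integral>x. (cmod (f x))\<^sup>2 \<partial>\<mu>)"


section \<open>Unitary representations\<close>

definition unitary_op :: "('h::chilbert_space \<Rightarrow> 'h) \<Rightarrow> bool"
  where "unitary_op U \<longleftrightarrow>
    (\<forall>\<phi> \<psi>. U (\<phi> + \<psi>) = U \<phi> + U \<psi>) \<and>
    (\<forall>a \<phi>. U (a *\<^sub>C \<phi>) = a *\<^sub>C U \<phi>) \<and>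
    (\<forall>\<phi> \<psi>. cinner (U \<phi>) (U \<psi>) = cinner \<phi> \<psi>) \<and>
    surj U"

definition unitary_rep :: "('g::{topological_group_add, t2_space} \<Rightarrow> 'h::chilbert_space \<Rightarrow> 'h) \<Rightarrow> bool"
  where "unitary_rep \<pi> \<longleftrightarrow>
    (\<forall>x. unitary_op (\<pi> x)) \<and>
    (\<forall>x y. \<pi> (x + y) = \<pi> x \<circ> \<pi> y) \<and>
    (\<forall>\<phi>. continuous_on UNIV (\<lambda>x. \<pi> x \<phi>))"

definition coeff_op :: "('g \<Rightarrow> 'h::chilbert_space \<Rightarrow> 'h) \<Rightarrow> 'h \<Rightarrow> 'h \<Rightarrow> 'g \<Rightarrow> complex"
  where "coeff_op \<pi> \<eta> \<phi> x = cinner \<phi> (\<pi> x \<eta>)"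

text \<open>Since \<open>coeff_op \<pi> \<eta>\<close> is linear, it is isometric if and only if it preserves norms.\<close>

definition admissible :: "'g measure \<Rightarrow> ('g \<Rightarrow> 'h::chilbert_space \<Rightarrow> 'h) \<Rightarrow> 'h \<Rightarrow> bool"
  where "admissible \<mu> \<pi> \<eta> \<longleftrightarrow>
    (\<forall>\<phi>. coeff_op \<pi> \<eta> \<phi> \<in> L2 \<mu> \<and> L2_norm \<mu> (coeff_op \<pi> \<eta> \<phi>) = norm \<phi>)"

definition square_integrable_rep ::
    "'g::{topological_group_add, t2_space} measure \<Rightarrow> ('g \<Rightarrow> 'h::chilbert_space \<Rightarrow> 'h) \<Rightarrow> bool"
  where "square_integrable_rep \<mu> \<pi> \<longleftrightarrow> unitary_rep \<pi> \<and> (\<exists>\<eta>. admissible \<mu> \<pi> \<eta>)"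


section \<open>Sampling spaces\<close>

text \<open>Subspaces of \<open>L\<^sup>2\<close> consisting of continuous functions are given by their continuous
  representatives, which are unique because nonempty open sets have positive Haar measure.
  In the closedness condition the \<open>L\<^sup>2\<close>-limit \<open>g\<close> is an arbitrary representative, so it
  belongs to the subspace up to equality almost everywhere.\<close>

definition closed_L2_subspace :: "'g measure \<Rightarrow> ('g \<Rightarrow> complex) set \<Rightarrow> bool"
  where "closed_L2_subspace \<mu> H \<longleftrightarrow>
    H \<subseteq> L2 \<mu> \<and>
    (\<lambda>x. 0) \<in> H \<and>
    (\<forall>f \<in> H. \<forall>g \<in> H. (\<lambda>x. f x + g x) \<in> H) \<and>
    (\<forall>a. \<forall>f \<in> H. (\<lambda>x. a * f x) \<in> H) \<and>
    (\<forall>f g. (\<forall>n::nat. f n \<in> H) \<and> g \<in> L2 \<mu> \<and> (\<lambda>n. L2_norm \<mu> (\<lambda>x. f n x - g x)) \<longlonglongrightarrow> 0 \<longrightarrow>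
      (\<exists>h \<in> H. AE x in \<mu>. g x = h x))"

definition left_translation_invariant :: "('g::group_add \<Rightarrow> complex) set \<Rightarrow> bool"
  where "left_translation_invariant H \<longleftrightarrow> (\<forall>x. \<forall>f \<in> H. (\<lambda>y. f (- x + y)) \<in> H)"

text \<open>The index set \<open>\<Gamma>\<close> carries no order, so series over \<open>\<Gamma>\<close> converge along the net of
  finite subsets of \<open>\<Gamma>\<close>.\<close>

definition sinc_type ::
    "'g::{topological_group_add, t2_space} measure \<Rightarrow> 'g set \<Rightarrow> ('g \<Rightarrow> complex) set \<Rightarrow> ('g \<Rightarrow> complex) \<Rightarrow> bool"
  where "sinc_type \<mu> \<Gamma> H S \<longleftrightarrow>
    S \<in> H \<and>
    (\<forall>f \<in> H.
      ((\<lambda>F. L2_norm \<mu> (\<lambda>x. (\<Sum>\<gamma>\<in>F. f \<gamma> * S (- \<gamma> + x)) - f x)) \<longlongrightarrow> 0) (finite_subsets_at_top \<Gamma>) \<and>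
      uniform_limit UNIV (\<lambda>F x. \<Sum>\<gamma>\<in>F. f \<gamma> * S (- \<gamma> + x)) f (finite_subsets_at_top \<Gamma>))"

definition sampling_space ::
    "'g::{topological_group_add, t2_space} measure \<Rightarrow> 'g set \<Rightarrow> ('g \<Rightarrow> complex) set \<Rightarrow> bool"
  where "sampling_space \<mu> \<Gamma> H \<longleftrightarrow>
    closed_L2_subspace \<mu> H \<and>
    left_translation_invariant H \<and>
    (\<forall>f \<in> H. continuous_on UNIV f) \<and>
    (\<exists>c>0. \<forall>f \<in> H. ((\<lambda>\<gamma>. (cmod (f \<gamma>))\<^sup>2) has_sum (c * (L2_norm \<mu> f)\<^sup>2)) \<Gamma>) \<and>
    (\<exists>S. sinc_type \<mu> \<Gamma> H S)"

end

theory Submission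
  imports Defs
begin

text \<open>Let \<open>T\<^sub>F \<phi> = (\<Sum>i\<in>F. \<langle>\<phi>, e i\<rangle> e i)\<close> be the finite partial sums of the frame operator of a
  tight frame with constant \<open>c\<close>. The Bessel bound gives
  \<open>\<parallel>T\<^sub>F \<phi>\<parallel>\<^sup>2 \<le> c (\<Sum>i\<in>F. \<bar>\<langle>\<phi>, e i\<rangle>\<bar>\<^sup>2)\<close>, hence
  \<open>\<parallel>c \<phi> - T\<^sub>F \<phi>\<parallel>\<^sup>2 \<le> c (c \<parallel>\<phi>\<parallel>\<^sup>2 - (\<Sum>i\<in>F. \<bar>\<langle>\<phi>, e i\<rangle>\<bar>\<^sup>2))\<close>, which tends to \<open>0\<close>. For the frame
  \<open>\<pi> \<gamma> \<eta>\<close>, the operator \<open>V\<^sub>\<eta>\<close> maps \<open>T\<^sub>F \<phi> / c\<close> to the partial sum of the sinc expansion of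
  \<open>V\<^sub>\<eta> \<phi>\<close>. Since \<open>V\<^sub>\<eta>\<close> is isometric into \<open>L\<^sup>2\<close> and bounded into the supremum norm, the expansion
  converges in both senses.\<close>

section \<open>Complex inner product calculus\<close>

lemma cinner_scaleC_right: "cinner x (a *\<^sub>C y) = cnj a * cinner x y"
  using cinner_scaleC_left cinner_commute by (metis complex_cnj_mult)

lemma cinner_scaleR_left: "cinner (r *\<^sub>R x) y = of_real r * cinner x y"
  by (simp add: scaleR_scaleC cinner_scaleC_left)

lemma cinner_zero_left [simp]: "cinner 0 y = 0"
  using cinner_scaleR_left[of 0 0 y] by simp

lemma cinner_minus_left: "cinner (- x) y = - cinner x y"
  using cinner_scaleR_left[of "-1" x y] by simp

lemma cinner_diff_left: "cinner (x - y) z = cinner x z - cinner y z"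
  using cinner_add_left[of x "- y" z] by (simp add: cinner_minus_left)

lemma cinner_sum_left: "cinner (\<Sum>i\<in>F. f i) y = (\<Sum>i\<in>F. cinner (f i) y)"
  by (induction F rule: infinite_finite_induct) (simp_all add: cinner_add_left)

lemma norm_scaleC: "norm (a *\<^sub>C x) = cmod a * norm x"
proof -
  have "(norm (a *\<^sub>C x))\<^sup>2 = Re ((a * cnj a) * cinner x x)"
    by (simp only: power2_norm_eq_inner inner_eq_Re_cinner cinner_scaleC_left cinner_scaleC_right
        mult_ac)
  also have "\<dots> = (cmod a * norm x)\<^sup>2"
    by (simp only: complex_norm_square[symmetric] Re_complex_of_real flip: of_real_power)
      (simp add: power_mult_distrib power2_norm_eq_inner[of x] inner_eq_Re_cinner[of x])
  finally have "(norm (a *\<^sub>C x))\<^sup>2 = (cmod a * norm x)\<^sup>2" .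
  then show ?thesis
    by (simp add: power2_eq_iff_nonneg)
qed

text \<open>Rotating \<open>x\<close> by a unimodular scalar makes \<open>cinner x y\<close> real
  and nonnegative, so it becomes a real inner product and the real Cauchy-Schwarz inequality
  applies.\<close>

lemma norm_cinner_le: "cmod (cinner x y) \<le> norm x * norm y"
proof -
  obtain a where a: "cmod a = 1" "a * cinner x y = of_real (cmod (cinner x y))"
  proof (cases "cinner x y = 0")
    case False
    have "cnj (cinner x y) * cinner x y = of_real (cmod (cinner x y)) * of_real (cmod (cinner x y))"
      using complex_norm_square[of "cinner x y"] by (simp add: power2_eq_square mult_ac)
    with False show ?thesis
      by (intro that[of "cnj (cinner x y) / of_real (cmod (cinner x y))"])
        (simp_all add: norm_divide)
  qed (use that[of 1] in simp)
  have "cmod (cinner x y) = inner (a *\<^sub>C x) y"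
    by (simp add: inner_eq_Re_cinner cinner_scaleC_left a)
  also have "\<dots> \<le> norm (a *\<^sub>C x) * norm y"
    by (rule norm_cauchy_schwarz)
  finally show ?thesis
    by (simp add: norm_scaleC a)
qed

text \<open>Real and imaginary parts of \<open>cinner\<close> are real inner products, which are
  continuous.\<close>

lemma continuous_on_cinner_right [continuous_intros]:
  assumes "continuous_on A f"
  shows "continuous_on A (\<lambda>x. cinner \<phi> (f x))"
proof -
  have "cinner \<phi> y = Complex (inner \<phi> y) (- inner (\<i> *\<^sub>C \<phi>) y)" for y
    by (simp add: inner_eq_Re_cinner cinner_scaleC_left complex_eq_iff)
  then show ?thesis
    unfolding Complex_eq by (simp, intro continuous_intros assms)
qed

section \<open>Expansions in tight frames\<close>

lemma tight_frame_expansion_finite_bound: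
  fixes e :: "'i \<Rightarrow> 'h::chilbert_space"
  assumes "tight_frame I e c" "finite F" "F \<subseteq> I"
  shows "(norm (c *\<^sub>R \<phi> - (\<Sum>i\<in>F. cinner \<phi> (e i) *\<^sub>C e i)))\<^sup>2
    \<le> c * (c * (norm \<phi>)\<^sup>2 - (\<Sum>i\<in>F. (cmod (cinner \<phi> (e i)))\<^sup>2))"
proof -
  have c: "c > 0" and frame: "((\<lambda>i. (cmod (cinner \<psi> (e i)))\<^sup>2) has_sum (c * (norm \<psi>)\<^sup>2)) I" for \<psi>
    using assms(1) by (auto simp: tight_frame_def)
  have bessel: "(\<Sum>i\<in>F. (cmod (cinner \<psi> (e i)))\<^sup>2) \<le> c * (norm \<psi>)\<^sup>2" for \<psi>
    by (rule has_sum_mono_neutral[OF has_sum_finite[OF assms(2)] frame]) (use assms(3) in auto)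
  define S where "S = (\<Sum>i\<in>F. (cmod (cinner \<phi> (e i)))\<^sup>2)"
  define T where "T = (\<Sum>i\<in>F. cinner \<phi> (e i) *\<^sub>C e i)"
  have inner_T: "inner T \<psi> = (\<Sum>i\<in>F. Re (cinner \<phi> (e i) * cnj (cinner \<psi> (e i))))" for \<psi>
    by (simp add: T_def inner_eq_Re_cinner cinner_sum_left cinner_scaleC_left
        cinner_commute[of "e _" \<psi>])
  have T\<phi>: "inner T \<phi> = S"
    unfolding inner_T S_def by (simp add: complex_norm_square[symmetric] flip: of_real_power)
  have sq: "(cmod (a - of_real r * b))\<^sup>2 = (cmod a)\<^sup>2 - 2 * r * Re (a * cnj b) + r\<^sup>2 * (cmod b)\<^sup>2"
    for a b r
    by (simp only: cmod_power2) (simp add: power2_eq_square algebra_simps)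
  \<comment> \<open>\<open>T\<close> approximates \<open>c *\<^sub>R \<phi>\<close>, so its
    coefficients are compared with those of \<open>\<phi>\<close> after division by
    \<open>c\<close>. By \<open>inner_T\<close> at \<open>T\<close> itself the cross terms add up to
    \<open>inner T T\<close>, and \<open>bessel\<close> for \<open>T\<close> absorbs half of
    them.\<close>
  have "0 \<le> (\<Sum>i\<in>F. (cmod (cinner \<phi> (e i) - of_real (1 / c) * cinner T (e i)))\<^sup>2)"
    by (intro sum_nonneg) simp
  also have "\<dots> = S - 2 * (1 / c) * inner T T + (1 / c)\<^sup>2 * (\<Sum>i\<in>F. (cmod (cinner T (e i)))\<^sup>2)"
    unfolding sq inner_T S_def by (simp only: sum.distrib sum_subtractf sum_distrib_left)
  also have "\<dots> \<le> S - 2 * (1 / c) * inner T T + (1 / c)\<^sup>2 * (c * (norm T)\<^sup>2)"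
    by (intro add_left_mono mult_left_mono bessel) simp
  also have "\<dots> = S - (norm T)\<^sup>2 / c"
    using c by (simp add: power2_eq_square field_simps flip: power2_norm_eq_inner)
  finally have T: "(norm T)\<^sup>2 \<le> c * S"
    using c by (simp add: field_simps)
  \<comment> \<open>The cross term is exact because \<open>inner T \<phi>\<close> equals
    \<open>S\<close>.\<close>
  have "(norm (c *\<^sub>R \<phi> - T))\<^sup>2 = c\<^sup>2 * (norm \<phi>)\<^sup>2 - 2 * c * S + (norm T)\<^sup>2"
    unfolding power2_norm_eq_inner
    by (simp add: inner_diff_left inner_diff_right T\<phi> inner_commute[of \<phi> T]
        power2_eq_square algebra_simps)
  with T show ?thesis
    unfolding S_def[symmetric] T_def[symmetric] by (simp add: power2_eq_square algebra_simps)
qed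

lemma tight_frame_expansion:
  fixes e :: "'i \<Rightarrow> 'h::chilbert_space"
  assumes "tight_frame I e c"
  shows "((\<lambda>F. norm ((1 / c) *\<^sub>R (\<Sum>i\<in>F. cinner \<phi> (e i) *\<^sub>C e i) - \<phi>)) \<longlongrightarrow> 0)
    (finite_subsets_at_top I)"
proof -
  let ?T = "\<lambda>F. \<Sum>i\<in>F. cinner \<phi> (e i) *\<^sub>C e i"
  let ?R = "\<lambda>F. c * (c * (norm \<phi>)\<^sup>2 - (\<Sum>i\<in>F. (cmod (cinner \<phi> (e i)))\<^sup>2))"
  have c: "c > 0"
    and frame: "((\<lambda>F. \<Sum>i\<in>F. (cmod (cinner \<phi> (e i)))\<^sup>2) \<longlongrightarrow> c * (norm \<phi>)\<^sup>2) (finite_subsets_at_top I)"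
    using assms by (auto simp: tight_frame_def has_sum_def)
  \<comment> \<open>The limit is 0; it stays unsimplified so that its shape matches the limit
    rules.\<close>
  have lim: "((\<lambda>F. sqrt (?R F) / c) \<longlongrightarrow> sqrt (c * (c * (norm \<phi>)\<^sup>2 - c * (norm \<phi>)\<^sup>2)) / c)
      (finite_subsets_at_top I)"
    by (intro tendsto_intros frame) (use c in simp)
  have "norm ((1 / c) *\<^sub>R ?T F - \<phi>) \<le> sqrt (?R F) / c" if "finite F" "F \<subseteq> I" for F
  proof -
    have "norm (c *\<^sub>R \<phi> - ?T F) \<le> sqrt (?R F)"
      by (rule real_le_rsqrt) (rule tight_frame_expansion_finite_bound[OF assms that])
    moreover have "(1 / c) *\<^sub>R ?T F - \<phi> = (- 1 / c) *\<^sub>R (c *\<^sub>R \<phi> - ?T F)"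
      using c by (simp add: scaleR_diff_right)
    ultimately show ?thesis
      using c by (simp add: divide_right_mono)
  qed
  then have "\<forall>\<^sub>F F in finite_subsets_at_top I. norm (norm ((1 / c) *\<^sub>R ?T F - \<phi>)) \<le> sqrt (?R F) / c"
    by (simp add: eventually_finite_subsets_at_top_weakI)
  then show ?thesis
    by (rule Lim_null_comparison) (use lim in simp)
qed

section \<open>Square-integrable functions\<close>

lemma cmod_diff_square_le: "(cmod (a - b))\<^sup>2 \<le> 2 * (cmod a)\<^sup>2 + 2 * (cmod b)\<^sup>2"
proof -
  have "(cmod (a - b))\<^sup>2 \<le> (cmod a + cmod b)\<^sup>2"
    by (intro power_mono norm_triangle_ineq4) simp
  also have "\<dots> \<le> 2 * (cmod a)\<^sup>2 + 2 * (cmod b)\<^sup>2"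
    using zero_le_power2[of "cmod a - cmod b"] by (simp add: power2_sum power2_diff)
  finally show ?thesis .
qed

lemma L2_norm_square: "(L2_norm \<mu> f)\<^sup>2 = (\<integral>x. (cmod (f x))\<^sup>2 \<partial>\<mu>)"
  by (simp add: L2_norm_def)

lemma L2_norm_nonneg [simp]: "0 \<le> L2_norm \<mu> f"
  by (simp add: L2_norm_def)

lemma L2_norm_minus_commute: "L2_norm \<mu> (\<lambda>x. f x - g x) = L2_norm \<mu> (\<lambda>x. g x - f x)"
  by (simp add: L2_norm_def norm_minus_commute)

lemma L2_diff:
  assumes "f \<in> L2 \<mu>" "g \<in> L2 \<mu>"
  shows "(\<lambda>x. f x - g x) \<in> L2 \<mu>"
proof -
  have [measurable]: "f \<in> borel_measurable \<mu>" "g \<in> borel_measurable \<mu>"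
    using assms by (auto simp: L2_def)
  have "integrable \<mu> (\<lambda>x. (cmod (f x - g x))\<^sup>2)"
    by (rule Bochner_Integration.integrable_bound[of _ "\<lambda>x. 2 * (cmod (f x))\<^sup>2 + 2 * (cmod (g x))\<^sup>2"])
      (use assms cmod_diff_square_le in \<open>auto simp: L2_def\<close>)
  then show ?thesis
    by (auto simp: L2_def)
qed

text \<open>A weak substitute for Minkowski's inequality, obtained by integrating a pointwise bound.
  The factor 2 is harmless where only convergence to 0 matters.\<close>

lemma L2_norm_diff_square_le:
  assumes "f \<in> L2 \<mu>" "g \<in> L2 \<mu>"
  shows "(L2_norm \<mu> (\<lambda>x. f x - g x))\<^sup>2 \<le> 2 * (L2_norm \<mu> f)\<^sup>2 + 2 * (L2_norm \<mu> g)\<^sup>2"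
proof -
  have "(\<integral>x. (cmod (f x - g x))\<^sup>2 \<partial>\<mu>) \<le> (\<integral>x. 2 * (cmod (f x))\<^sup>2 + 2 * (cmod (g x))\<^sup>2 \<partial>\<mu>)"
    using assms L2_diff[OF assms]
    by (intro integral_mono cmod_diff_square_le) (auto simp: L2_def)
  also have "\<dots> = 2 * (\<integral>x. (cmod (f x))\<^sup>2 \<partial>\<mu>) + 2 * (\<integral>x. (cmod (g x))\<^sup>2 \<partial>\<mu>)"
    using assms by (simp add: L2_def)
  finally show ?thesis
    by (simp add: L2_norm_square)
qed

lemma L2_norm_eq_0D:
  assumes "f \<in> L2 \<mu>" "L2_norm \<mu> f = 0"
  shows "AE x in \<mu>. f x = 0"
proof -
  have "(\<integral>x. (cmod (f x))\<^sup>2 \<partial>\<mu>) = 0"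
    using assms(2) by (simp flip: L2_norm_square)
  then show ?thesis
    using assms(1) by (subst (asm) integral_nonneg_eq_0_iff_AE) (auto simp: L2_def)
qed

section \<open>The range of the coefficient operator\<close>

lemma coeff_op_add: "coeff_op \<pi> \<eta> (\<phi> + \<psi>) x = coeff_op \<pi> \<eta> \<phi> x + coeff_op \<pi> \<eta> \<psi> x"
  by (simp add: coeff_op_def cinner_add_left)

lemma coeff_op_diff: "coeff_op \<pi> \<eta> (\<phi> - \<psi>) x = coeff_op \<pi> \<eta> \<phi> x - coeff_op \<pi> \<eta> \<psi> x"
  by (simp add: coeff_op_def cinner_diff_left)

lemma coeff_op_scaleC: "coeff_op \<pi> \<eta> (a *\<^sub>C \<phi>) x = a * coeff_op \<pi> \<eta> \<phi> x"
  by (simp add: coeff_op_def cinner_scaleC_left)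

lemma admissible_L2: "admissible \<mu> \<pi> \<eta> \<Longrightarrow> coeff_op \<pi> \<eta> \<phi> \<in> L2 \<mu>"
  by (simp add: admissible_def)

lemma admissible_L2_norm: "admissible \<mu> \<pi> \<eta> \<Longrightarrow> L2_norm \<mu> (coeff_op \<pi> \<eta> \<phi>) = norm \<phi>"
  by (simp add: admissible_def)

text \<open>Closedness holds because the operator is isometric: an \<open>L2\<close>-convergent
  sequence of images comes from a Cauchy sequence of vectors, and the image of the limit vector
  agrees with \<open>g\<close> almost everywhere.\<close>

lemma closed_L2_subspace_coeff_op:
  fixes \<pi> :: "'g \<Rightarrow> 'h::chilbert_space \<Rightarrow> 'h"
  assumes adm: "admissible \<mu> \<pi> \<eta>"
  shows "closed_L2_subspace \<mu> (range (coeff_op \<pi> \<eta>))"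
  unfolding closed_L2_subspace_def
proof (intro conjI allI impI ballI)
  let ?V = "coeff_op \<pi> \<eta>"
  show "range ?V \<subseteq> L2 \<mu>"
    using admissible_L2[OF adm] by auto
  show "(\<lambda>x. 0) \<in> range ?V"
    by (rule range_eqI[of _ _ 0]) (simp add: coeff_op_def fun_eq_iff)
  show "(\<lambda>x. f x + g x) \<in> range ?V" if "f \<in> range ?V" "g \<in> range ?V" for f g
    using that by (auto simp flip: coeff_op_add)
  show "(\<lambda>x. a * f x) \<in> range ?V" if "f \<in> range ?V" for a f
    using that by (auto simp flip: coeff_op_scaleC)
  fix f :: "nat \<Rightarrow> 'g \<Rightarrow> complex" and g
  assume "(\<forall>n. f n \<in> range ?V) \<and> g \<in> L2 \<mu> \<and> (\<lambda>n. L2_norm \<mu> (\<lambda>x. f n x - g x)) \<longlonglongrightarrow> 0"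
  then have "\<forall>n. \<exists>\<phi>. f n = ?V \<phi>" and g: "g \<in> L2 \<mu>"
    and lim: "(\<lambda>n. L2_norm \<mu> (\<lambda>x. f n x - g x)) \<longlonglongrightarrow> 0"
    by auto
  then obtain \<phi> where f: "f n = ?V (\<phi> n)" for n
    by metis
  let ?d = "\<lambda>n. L2_norm \<mu> (\<lambda>x. ?V (\<phi> n) x - g x)"
  have diff: "(\<lambda>x. ?V \<psi> x - g x) \<in> L2 \<mu>" for \<psi>
    by (intro L2_diff admissible_L2[OF adm] g)
  have L2_dist: "L2_norm \<mu> (\<lambda>x. ?V \<psi> x - ?V \<psi>' x) = norm (\<psi> - \<psi>')" for \<psi> \<psi>'
    using admissible_L2_norm[OF adm, of "\<psi> - \<psi>'"] by (simp add: coeff_op_diff[abs_def])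
  have d: "?d \<longlonglongrightarrow> 0"
    using lim by (simp add: f)
  have "Cauchy \<phi>"
  proof (rule CauchyI)
    fix \<epsilon> :: real assume \<epsilon>: "0 < \<epsilon>"
    \<comment> \<open>The choice \<open>\<epsilon> / 2\<close> gives exactly
      \<open>\<epsilon>\<^sup>2\<close> when inserted twice into
      \<open>2 * (\<epsilon> / 2)\<^sup>2\<close>.\<close>
    then obtain N where N: "?d n < \<epsilon> / 2" if "n \<ge> N" for n
      using LIMSEQ_D[OF d, of "\<epsilon> / 2"] by auto
    show "\<exists>N. \<forall>m\<ge>N. \<forall>n\<ge>N. norm (\<phi> m - \<phi> n) < \<epsilon>"
    proof (intro exI allI impI)
      fix m n assume mn: "N \<le> m" "N \<le> n"
      have "(norm (\<phi> m - \<phi> n))\<^sup>2 \<le> 2 * (?d m)\<^sup>2 + 2 * (?d n)\<^sup>2"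
        using L2_norm_diff_square_le[OF diff diff, of "\<phi> m" "\<phi> n"] by (simp add: L2_dist)
      also have "\<dots> < 2 * (\<epsilon> / 2)\<^sup>2 + 2 * (\<epsilon> / 2)\<^sup>2"
        by (intro add_strict_mono mult_strict_left_mono power_strict_mono N mn) auto
      finally have "(norm (\<phi> m - \<phi> n))\<^sup>2 < \<epsilon>\<^sup>2"
        by (simp add: power2_eq_square)
      then show "norm (\<phi> m - \<phi> n) < \<epsilon>"
        by (rule power_less_imp_less_base) (use \<epsilon> in simp)
    qed
  qed
  then obtain \<psi> where \<psi>: "\<phi> \<longlonglongrightarrow> \<psi>"
    using Cauchy_convergent convergent_def by blast
  let ?D = "L2_norm \<mu> (\<lambda>x. ?V \<psi> x - g x)"
  \<comment> \<open>Here \<open>?V \<psi> - g\<close> is split as the difference of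
    \<open>?V (\<psi> - \<phi> n)\<close> and \<open>g - ?V (\<phi> n)\<close>.\<close>
  have bound: "?D\<^sup>2 \<le> 2 * (norm (\<psi> - \<phi> n))\<^sup>2 + 2 * (?d n)\<^sup>2" for n
    using L2_norm_diff_square_le[OF admissible_L2[OF adm] L2_diff[OF g admissible_L2[OF adm]],
        of "\<psi> - \<phi> n" "\<phi> n"]
    by (simp add: coeff_op_diff admissible_L2_norm[OF adm] L2_norm_minus_commute[of \<mu> g])
  have "(\<lambda>n. 2 * (norm (\<psi> - \<phi> n))\<^sup>2 + 2 * (?d n)\<^sup>2) \<longlonglongrightarrow> 2 * (norm (\<psi> - \<psi>))\<^sup>2 + 2 * 0\<^sup>2"
    by (intro tendsto_intros \<psi> d)
  then have "?D\<^sup>2 \<le> 0"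
    using bound by (intro LIMSEQ_le_const) auto
  then have "AE x in \<mu>. ?V \<psi> x - g x = 0"
    by (intro L2_norm_eq_0D diff) simp
  then show "\<exists>h \<in> range ?V. AE x in \<mu>. g x = h x"
    by (intro bexI[of _ "?V \<psi>"]) (auto elim!: eventually_mono)
qed

section \<open>Translation, boundedness and the sinc expansion\<close>

lemma unitary_rep_cinner: "unitary_rep \<pi> \<Longrightarrow> cinner (\<pi> x \<phi>) (\<pi> x \<psi>) = cinner \<phi> \<psi>"
  by (simp add: unitary_rep_def unitary_op_def)

lemma unitary_rep_add: "unitary_rep \<pi> \<Longrightarrow> \<pi> (x + y) \<phi> = \<pi> x (\<pi> y \<phi>)"
  by (simp add: unitary_rep_def)

lemma unitary_rep_norm: "unitary_rep \<pi> \<Longrightarrow> norm (\<pi> x \<phi>) = norm \<phi>"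
  by (simp add: norm_eq_sqrt_inner inner_eq_Re_cinner unitary_rep_cinner)

text \<open>The coefficient operator intertwines \<open>\<pi>\<close> with left translation: after
  writing \<open>y\<close> as \<open>x + (- x + y)\<close>, unitarity cancels \<open>\<pi> x\<close>
  on both sides.\<close>

lemma coeff_op_translate:
  assumes "unitary_rep \<pi>"
  shows "coeff_op \<pi> \<eta> \<phi> (- x + y) = coeff_op \<pi> \<eta> (\<pi> x \<phi>) y"
proof -
  have "coeff_op \<pi> \<eta> (\<pi> x \<phi>) y = cinner (\<pi> x \<phi>) (\<pi> (x + (- x + y)) \<eta>)"
    by (simp add: coeff_op_def flip: add.assoc)
  also have "\<dots> = coeff_op \<pi> \<eta> \<phi> (- x + y)"
    by (simp only: unitary_rep_add[OF assms, of x] unitary_rep_cinner[OF assms] coeff_op_def)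
  finally show ?thesis ..
qed

text \<open>The bound does not depend on \<open>x\<close>, which turns norm convergence of vectors
  into uniform convergence of their coefficient functions.\<close>

lemma coeff_op_bounded:
  assumes "unitary_rep \<pi>"
  shows "cmod (coeff_op \<pi> \<eta> \<phi> x) \<le> norm \<phi> * norm \<eta>"
  using norm_cinner_le[of \<phi> "\<pi> x \<eta>"] by (simp add: coeff_op_def unitary_rep_norm[OF assms])

lemma sinc_type_coeff_op:
  fixes \<mu> :: "'g::{topological_group_add, t2_space} measure"
    and \<pi> :: "'g \<Rightarrow> 'h::chilbert_space \<Rightarrow> 'h"
  assumes rep: "unitary_rep \<pi>" and adm: "admissible \<mu> \<pi> \<eta>"
    and frame: "tight_frame \<Gamma> (\<lambda>\<gamma>. \<pi> \<gamma> \<eta>) c"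
  shows "sinc_type \<mu> \<Gamma> (range (coeff_op \<pi> \<eta>)) (\<lambda>x. complex_of_real (1 / c) * coeff_op \<pi> \<eta> \<eta> x)"
    (is "sinc_type \<mu> \<Gamma> _ ?S")
  unfolding sinc_type_def
proof (intro conjI ballI)
  show "?S \<in> range (coeff_op \<pi> \<eta>)"
    by (rule range_eqI[of _ _ "complex_of_real (1 / c) *\<^sub>C \<eta>"]) (simp add: coeff_op_scaleC fun_eq_iff)
  fix f assume "f \<in> range (coeff_op \<pi> \<eta>)"
  then obtain \<phi> where f: "f = coeff_op \<pi> \<eta> \<phi>"
    by auto
  let ?R = "\<lambda>F. (1 / c) *\<^sub>R (\<Sum>\<gamma>\<in>F. cinner \<phi> (\<pi> \<gamma> \<eta>) *\<^sub>C \<pi> \<gamma> \<eta>) - \<phi>"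
  \<comment> \<open>The translate of \<open>?S\<close> by \<open>\<gamma>\<close> is the image of
    \<open>\<pi> \<gamma> \<eta>\<close> divided by \<open>c\<close>, and \<open>f \<gamma>\<close>
    is the frame coefficient of \<open>\<phi>\<close>. Linearity then gives one vector
    \<open>?R F\<close> that controls both modes of convergence.\<close>
  have error: "(\<Sum>\<gamma>\<in>F. f \<gamma> * ?S (- \<gamma> + x)) - f x = coeff_op \<pi> \<eta> (?R F) x" for F x
    unfolding f coeff_op_translate[OF rep]
    by (simp add: coeff_op_def cinner_diff_left cinner_scaleR_left cinner_sum_left
        cinner_scaleC_left sum_distrib_left mult_ac)
  have lim: "((\<lambda>F. norm (?R F)) \<longlongrightarrow> 0) (finite_subsets_at_top \<Gamma>)"
    by (rule tight_frame_expansion[OF frame])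
  show "((\<lambda>F. L2_norm \<mu> (\<lambda>x. (\<Sum>\<gamma>\<in>F. f \<gamma> * ?S (- \<gamma> + x)) - f x)) \<longlongrightarrow> 0) (finite_subsets_at_top \<Gamma>)"
    using lim by (simp only: error admissible_L2_norm[OF adm])
  show "uniform_limit UNIV (\<lambda>F x. \<Sum>\<gamma>\<in>F. f \<gamma> * ?S (- \<gamma> + x)) f (finite_subsets_at_top \<Gamma>)"
  proof (rule uniform_limitI)
    fix \<epsilon> :: real assume "0 < \<epsilon>"
    moreover have "((\<lambda>F. norm (?R F) * norm \<eta>) \<longlongrightarrow> 0) (finite_subsets_at_top \<Gamma>)"
      using lim by (rule tendsto_mult_left_zero)
    ultimately have "\<forall>\<^sub>F F in finite_subsets_at_top \<Gamma>. norm (?R F) * norm \<eta> < \<epsilon>"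
      by (intro order_tendstoD)
    then show "\<forall>\<^sub>F F in finite_subsets_at_top \<Gamma>.
        \<forall>x\<in>UNIV. dist (\<Sum>\<gamma>\<in>F. f \<gamma> * ?S (- \<gamma> + x)) (f x) < \<epsilon>"
      unfolding dist_norm error
      by eventually_elim (use coeff_op_bounded[OF rep] le_less_trans in blast)
  qed
qed

theorem proposition2p2:
  fixes \<mu> :: "'g::{topological_group_add, t2_space} measure"
    and \<Gamma> :: "'g set"
    and \<pi> :: "'g \<Rightarrow> 'h::chilbert_space \<Rightarrow> 'h"
    and \<eta> :: 'h
    and c\<^sub>\<eta> :: real
  assumes "locally_compact_space (euclidean :: 'g topology)"
    and "left_haar_measure \<mu>"
    and "unitary_rep \<pi>"
    and "square_integrable_rep \<mu> \<pi>"
    and "admissible \<mu> \<pi> \<eta>"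
    and "tight_frame \<Gamma> (\<lambda>\<gamma>. \<pi> \<gamma> \<eta>) c\<^sub>\<eta>"
  shows "sampling_space \<mu> \<Gamma> (range (coeff_op \<pi> \<eta>)) \<and>
    sinc_type \<mu> \<Gamma> (range (coeff_op \<pi> \<eta>)) (\<lambda>x. complex_of_real (1 / c\<^sub>\<eta>) * coeff_op \<pi> \<eta> \<eta> x)"
proof -
  note sinc = sinc_type_coeff_op[OF assms(3,5,6)]
  have "left_translation_invariant (range (coeff_op \<pi> \<eta>))"
    by (auto simp: left_translation_invariant_def coeff_op_translate[OF assms(3)])
  moreover have "continuous_on UNIV (coeff_op \<pi> \<eta> \<phi>)" for \<phi>
    unfolding coeff_op_def[abs_def] using assms(3)
    by (intro continuous_intros) (simp add: unitary_rep_def)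
  \<comment> \<open>Samples at \<open>\<gamma>\<close> are frame coefficients and the
    \<open>L2\<close> norm is \<open>norm \<phi>\<close>, so the frame identity is the sampling
    identity with constant \<open>c\<^sub>\<eta>\<close>.\<close>
  moreover have "((\<lambda>\<gamma>. (cmod (coeff_op \<pi> \<eta> \<phi> \<gamma>))\<^sup>2) has_sum
      (c\<^sub>\<eta> * (L2_norm \<mu> (coeff_op \<pi> \<eta> \<phi>))\<^sup>2)) \<Gamma>" for \<phi>
    using assms(6) by (simp add: admissible_L2_norm[OF assms(5)] tight_frame_def coeff_op_def)
  moreover have "c\<^sub>\<eta> > 0"
    using assms(6) by (simp add: tight_frame_def)
  ultimately show ?thesis
    using sinc closed_L2_subspace_coeff_op[OF assms(5)] by (auto simp: sampling_space_def)
qed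

end
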